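(* Let $B\in\mathbb R^{d\times r}$ be a real matrix. The following are equivalent: (1) Some matrix obtained by repeating each column of $B$ a positive integer number of times (the numbers of repetitions may differ between columns) has its kernel spanned by sign vectors. (2) The kernel of $B$ is rational. (3) For every sufficiently large integer $k$, repeating each column of $B$ exactly $2k$ times produces a matrix whose kernel is spanned by sign vectors.
   Context: A sign vector is a vector with all entries in $\{-1,1\}$. The kernel of a matrix $Y$ with $n$ columns is spanned by sign vectors if the real linear span of $\ker Y\cap\{-1,1\}^n$ equals $\ker Y$ (the span of the empty set is $\{0\}$). A subspace of $\mathbb R^r$ is rational if it has a basis of rational vectors; the zero subspace is rational. *)

theory Defs
  imports Jordan_Normal_Form.Matrix_Kernel
begin

text \<open>Copies of a column are placed next to each other; \<open>m j\<close> is the number of copies of column \<open>j\<close>.\<close>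

definition repeat_cols :: "(nat \<Rightarrow> nat) \<Rightarrow> 'a mat \<Rightarrow> 'a mat" where
  "repeat_cols m B =
     mat_of_cols (dim_row B) (concat (map (\<lambda>j. replicate (m j) (col B j)) [0..<dim_col B]))"

definition sign_vec :: "real vec \<Rightarrow> bool" where
  "sign_vec v \<longleftrightarrow> (\<forall>i<dim_vec v. v $ i \<in> {-1, 1})"

definition rational_vec :: "real vec \<Rightarrow> bool" where
  "rational_vec v \<longleftrightarrow> (\<forall>i<dim_vec v. v $ i \<in> \<rat>)"

definition kernel_spanned_by_sign_vecs :: "real mat \<Rightarrow> bool" where
  "kernel_spanned_by_sign_vecs Y \<longleftrightarrow>
     LinearCombinations.module.span class_ring (module_vec TYPE(real) (dim_col Y))
       {v \<in> mat_kernel Y. sign_vec v} = mat_kernel Y"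

text \<open>The constant \<open>vectorspace.basis\<close> is only meaningful on a vector space, hence the
  explicit subspace condition.\<close>

definition rational_subspace :: "nat \<Rightarrow> real vec set \<Rightarrow> bool" where
  "rational_subspace n W \<longleftrightarrow>
     subspace class_ring W (module_vec TYPE(real) n) \<and>
     (\<exists>S. vectorspace.basis class_ring ((module_vec TYPE(real) n)\<lparr>carrier := W\<rparr>) S \<and>
          (\<forall>v\<in>S. rational_vec v))"

end

theory Submission
  imports Defs
begin

text \<open>
  Repeating the columns of \<open>B\<close> amounts to factoring through a summation map: if \<open>P\<close> is the 0/1
  matrix that adds up the coordinates of a long vector belonging to the copies of each column,
  then the repeated matrix is \<open>Y = B P\<close> (\<open>repeat_cols_eq_mult_block_sums\<close>). Hence \<open>ker Y\<close> is the
  preimage of \<open>ker B\<close> under \<open>P\<close>, and everything depends on which vectors \<open>P y\<close> arise from sign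
  vectors \<open>y\<close>.

  If every column occurs at least once, \<open>P\<close> is onto, so \<open>P\<close> carries a spanning set of \<open>ker Y\<close> to
  one of \<open>ker B\<close>. The image of a sign vector has integer entries; thus a kernel \<open>ker Y\<close> spanned by
  sign vectors makes \<open>ker B\<close> rational (\<open>rational_if_repetition_spanned\<close>).

  Conversely let every column occur \<open>2k\<close> times, and let \<open>U\<close> be the span of the sign vectors in
  \<open>ker Y\<close>. Two facts give \<open>U = ker Y\<close> (\<open>even_repetition_spanned\<close>). First, \<open>U\<close> contains \<open>ker P\<close>: a
  sign vector with \<open>k\<close> entries of each sign in every block lies in \<open>ker P\<close>, exchanging a \<open>1\<close> and a
  \<open>-1\<close> of the same block gives another one, and the differences \<open>e\<^sub>a - e\<^sub>b\<close> within blocks so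
  obtained span \<open>ker P\<close>. Secondly, \<open>P\<close> maps \<open>U\<close> onto \<open>ker B\<close>: the block sums of sign vectors are
  exactly the vectors with even entries in \<open>[-2k, 2k]\<close>, and for large \<open>k\<close> these include an even
  multiple of every vector of a given finite rational spanning set of \<open>ker B\<close>
  (\<open>eventually_sign_liftable\<close>).
\<close>

section \<open>Subspaces and spans of real vectors\<close>

abbreviation vspan :: "nat \<Rightarrow> real vec set \<Rightarrow> real vec set" where
  "vspan n \<equiv> LinearCombinations.module.span class_ring (module_vec TYPE(real) n)"

abbreviation vsubspace :: "nat \<Rightarrow> real vec set \<Rightarrow> bool" where
  "vsubspace n U \<equiv> submodule class_ring U (module_vec TYPE(real) n)"

lemma vsubspaceI:
  assumes "U \<subseteq> carrier_vec n" "0\<^sub>v n \<in> U"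
    and "\<And>u v. u \<in> U \<Longrightarrow> v \<in> U \<Longrightarrow> u + v \<in> U" "\<And>c u. u \<in> U \<Longrightarrow> c \<cdot>\<^sub>v u \<in> U"
  shows "vsubspace n U"
  using assms vec_module[of n, where 'a=real]
  by (auto simp: submodule_def module_vec_simps class_ring_simps)

lemma vsubspaceD:
  assumes "vsubspace n U"
  shows "U \<subseteq> carrier_vec n" "0\<^sub>v n \<in> U"
    and "\<And>u v. u \<in> U \<Longrightarrow> v \<in> U \<Longrightarrow> u + v \<in> U" "\<And>c u. u \<in> U \<Longrightarrow> c \<cdot>\<^sub>v u \<in> U"
    and "\<And>u v. u \<in> U \<Longrightarrow> v \<in> U \<Longrightarrow> u - v \<in> U"
proof -
  show 1: "U \<subseteq> carrier_vec n" "0\<^sub>v n \<in> U"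
    and 2: "\<And>u v. u \<in> U \<Longrightarrow> v \<in> U \<Longrightarrow> u + v \<in> U" "\<And>c u. u \<in> U \<Longrightarrow> c \<cdot>\<^sub>v u \<in> U"
    using assms by (auto simp: submodule_def module_vec_simps class_ring_simps)
  fix u v assume uv: "u \<in> U" "v \<in> U"
  then have "u - v = u + (-1) \<cdot>\<^sub>v v"
    using 1 by (intro eq_vecI) auto
  then show "u - v \<in> U" using 2 uv by simp
qed

lemma vsubspace_vspan:
  assumes "S \<subseteq> carrier_vec n" shows "vsubspace n (vspan n S)"
proof -
  interpret vec_space "TYPE(real)" n .
  show ?thesis using span_is_submodule assms by simp
qed

lemma subset_vspan:
  assumes "S \<subseteq> carrier_vec n" shows "S \<subseteq> vspan n S"
proof -
  interpret vec_space "TYPE(real)" n .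
  show ?thesis using in_own_span assms by simp
qed

lemma vspan_least:
  assumes "S \<subseteq> U" "vsubspace n U" shows "vspan n S \<subseteq> U"
proof -
  interpret vec_space "TYPE(real)" n .
  show ?thesis using span_is_subset assms by simp
qed

lemma vsubspace_mat_kernel:
  assumes "A \<in> carrier_mat d n" shows "vsubspace n (mat_kernel A)"
  using assms
  by (intro vsubspaceI) (auto simp: mat_kernel mult_add_distrib_mat_vec mult_mat_vec)

lemma vsubspace_image:
  assumes P: "P \<in> carrier_mat r n" and U: "vsubspace n U"
  shows "vsubspace r ((\<lambda>y. P *\<^sub>v y) ` U)"
proof (rule vsubspaceI)
  note D = vsubspaceD[OF U]
  show "(\<lambda>y. P *\<^sub>v y) ` U \<subseteq> carrier_vec r" using P D(1) mult_mat_vec_carrier by blast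
  have "0\<^sub>v r = P *\<^sub>v 0\<^sub>v n" using P by auto
  then show "0\<^sub>v r \<in> (\<lambda>y. P *\<^sub>v y) ` U" using D(2) by blast
  fix u v assume "u \<in> (\<lambda>y. P *\<^sub>v y) ` U" "v \<in> (\<lambda>y. P *\<^sub>v y) ` U"
  then obtain x y where xy: "x \<in> U" "y \<in> U" "u = P *\<^sub>v x" "v = P *\<^sub>v y" by auto
  then have "u + v = P *\<^sub>v (x + y)"
    using mult_add_distrib_mat_vec[OF P subsetD[OF D(1)] subsetD[OF D(1)]] by simp
  then show "u + v \<in> (\<lambda>y. P *\<^sub>v y) ` U" using D(3) xy by blast
next
  note D = vsubspaceD[OF U]
  fix c u assume "u \<in> (\<lambda>y. P *\<^sub>v y) ` U"
  then obtain x where x: "x \<in> U" "u = P *\<^sub>v x" by auto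
  then have "c \<cdot>\<^sub>v u = P *\<^sub>v (c \<cdot>\<^sub>v x)"
    using mult_mat_vec[OF P subsetD[OF D(1)]] by simp
  then show "c \<cdot>\<^sub>v u \<in> (\<lambda>y. P *\<^sub>v y) ` U" using D(4) x by blast
qed

lemma mult_vspan_subset:
  assumes P: "P \<in> carrier_mat r n" and S: "S \<subseteq> carrier_vec n" and y: "y \<in> vspan n S"
  shows "P *\<^sub>v y \<in> vspan r ((\<lambda>y. P *\<^sub>v y) ` S)"
proof -
  let ?T = "(\<lambda>y. P *\<^sub>v y) ` S"
  have T: "?T \<subseteq> carrier_vec r" using P S mult_mat_vec_carrier by blast
  note D = vsubspaceD[OF vsubspace_vspan[OF T]]
  have "vsubspace n {y \<in> carrier_vec n. P *\<^sub>v y \<in> vspan r ?T}" (is "vsubspace n ?U")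
  proof (rule vsubspaceI)
    have "P *\<^sub>v 0\<^sub>v n = 0\<^sub>v r" using P by auto
    then show "0\<^sub>v n \<in> ?U" using D(2) by simp
  qed (use D P in \<open>auto simp: mult_add_distrib_mat_vec mult_mat_vec\<close>)
  moreover have "S \<subseteq> ?U" using S subset_vspan[OF T] by auto
  ultimately show ?thesis using vspan_least[of S ?U n] y by blast
qed

text \<open>A finite rational spanning set contains a basis, and a basis is finite because the ambient
  space is finite-dimensional. Finiteness is what later allows
  one bound on \<open>k\<close> to serve all spanning vectors.\<close>

lemma rational_subspace_mat_kernel_iff:
  assumes "B \<in> carrier_mat d r"
  shows "rational_subspace r (mat_kernel B) \<longleftrightarrow>
    (\<exists>S. finite S \<and> S \<subseteq> carrier_vec r \<and> (\<forall>v\<in>S. rational_vec v) \<and> vspan r S = mat_kernel B)"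
    (is "?L \<longleftrightarrow> ?R")
proof -
  interpret kernel d r B using assms by unfold_locales
  have K: "mat_kernel B \<subseteq> carrier_vec r" using mat_kernel_carrier[OF assms] .
  show ?thesis
  proof
    assume ?L
    then obtain S where S: "Ker.basis S" "\<forall>v\<in>S. rational_vec v"
      unfolding rational_subspace_def by auto
    have SK: "S \<subseteq> mat_kernel B" and li: "Ker.lin_indpt S" and gen: "Ker.span S = mat_kernel B"
      using S(1) by (auto simp: Ker.basis_def)
    have "NC.lin_indpt S" using li lindep_same[OF SK] by simp
    then have "finite S" using NC.fin_dim_li_fin[OF NC.fin_dim] SK K by auto
    then show ?R using SK K S(2) gen span_same[OF SK] by auto
  next
    assume ?R
    then obtain S where S: "finite S" "S \<subseteq> carrier_vec r" "\<forall>v\<in>S. rational_vec v"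
      "vspan r S = mat_kernel B" by auto
    have SK: "S \<subseteq> mat_kernel B" using subset_vspan[OF S(2)] S(4) by simp
    have "Ker.gen_set S" using span_same[OF SK] S(4) by simp
    then obtain T where T: "T \<subseteq> S" "minimal T (\<lambda>S. S \<subseteq> mat_kernel B \<and> Ker.gen_set S)"
      using minimal_exists[OF S(1), of "\<lambda>S. S \<subseteq> mat_kernel B \<and> Ker.gen_set S"] SK by auto
    have "Ker.lin_indpt T" using Ker.min_gen_is_li T(2) by simp
    then have "Ker.basis T" using T(2) by (auto simp: Ker.basis_def minimal_def)
    moreover have "subspace class_ring (mat_kernel B) NC.V"
      using vsubspace_mat_kernel[OF assms] vec_vs by (simp add: subspace_def)
    ultimately show ?L using T(1) S(3) unfolding rational_subspace_def by auto
  qed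
qed

section \<open>Repeated columns and block sums\<close>

text \<open>The \<open>i\<close>-th column of the repeated matrix is a copy of column \<open>block_index m r ! i\<close>.\<close>

definition block_index :: "(nat \<Rightarrow> nat) \<Rightarrow> nat \<Rightarrow> nat list" where
  "block_index m r = concat (map (\<lambda>j. replicate (m j) j) [0..<r])"

definition block :: "(nat \<Rightarrow> nat) \<Rightarrow> nat \<Rightarrow> nat \<Rightarrow> nat set" where
  "block m r j = {i. i < length (block_index m r) \<and> block_index m r ! i = j}"

definition block_sums :: "(nat \<Rightarrow> nat) \<Rightarrow> nat \<Rightarrow> real mat" where
  "block_sums m r = mat r (length (block_index m r)) (\<lambda>(j, i). of_bool (i \<in> block m r j))"

lemma block_sums_carrier [simp]:
  "block_sums m r \<in> carrier_mat r (length (block_index m r))"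
  by (simp add: block_sums_def)

lemma finite_block [simp]: "finite (block m r j)"
  by (simp add: block_def)

lemma block_subset: "block m r j \<subseteq> {..<length (block_index m r)}"
  by (auto simp: block_def)

lemma block_index_less: "i < length (block_index m r) \<Longrightarrow> block_index m r ! i < r"
  using nth_mem[of i "block_index m r"] by (auto simp: block_index_def)

lemma card_block: "card (block m r j) = (if j < r then m j else 0)"
proof -
  have "card (block m r j) = length (filter ((=) j) (block_index m r))"
    by (auto simp: block_def length_filter_conv_card intro!: arg_cong[where f=card])
  also have "\<dots> = (if j < r then m j else 0)"
    by (induction r) (auto simp: block_index_def filter_replicate less_Suc_eq)
  finally show ?thesis .
qed

lemma block_sums_mult_vec:
  assumes "y \<in> carrier_vec (length (block_index m r))"
  shows "block_sums m r *\<^sub>v y = vec r (\<lambda>j. \<Sum>i\<in>block m r j. y $ i)"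
proof (rule eq_vecI)
  fix j assume j: "j < dim_vec (vec r (\<lambda>j. \<Sum>i\<in>block m r j. y $ i))"
  let ?N = "length (block_index m r)"
  have "(block_sums m r *\<^sub>v y) $ j = (\<Sum>i<?N. of_bool (i \<in> block m r j) * y $ i)"
    using j assms by (auto simp: block_sums_def scalar_prod_def lessThan_atLeast0 intro!: sum.cong)
  also have "\<dots> = (\<Sum>i\<in>block m r j. y $ i)"
    by (rule sum.mono_neutral_cong_right) (use block_subset in auto)
  finally show "(block_sums m r *\<^sub>v y) $ j = vec r (\<lambda>j. \<Sum>i\<in>block m r j. y $ i) $ j"
    using j by simp
qed (simp add: block_sums_def)

lemma repeat_cols_eq_mult_block_sums:
  assumes B: "B \<in> carrier_mat d r"
  shows "repeat_cols m B = B * block_sums m r"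
proof -
  have "repeat_cols m B = mat_of_cols d (map (col B) (block_index m r))"
    using B by (simp add: repeat_cols_def block_index_def map_concat o_def)
  also have "\<dots> = B * block_sums m r"
  proof (rule eq_matI)
    fix k i assume "k < dim_row (B * block_sums m r)" "i < dim_col (B * block_sums m r)"
    then have k: "k < d" and i: "i < length (block_index m r)"
      using B by (auto simp: block_sums_def)
    have "(B * block_sums m r) $$ (k, i) = (\<Sum>j<r. B $$ (k, j) * of_bool (i \<in> block m r j))"
      using B k i by (auto simp: block_sums_def scalar_prod_def lessThan_atLeast0 intro!: sum.cong)
    also have "\<dots> = (\<Sum>j<r. if j = block_index m r ! i then B $$ (k, j) else 0)"
      using i by (auto simp: block_def intro!: sum.cong)
    also have "\<dots> = B $$ (k, block_index m r ! i)"
      using block_index_less[OF i] by simp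
    finally show "mat_of_cols d (map (col B) (block_index m r)) $$ (k, i)
        = (B * block_sums m r) $$ (k, i)"
      using B k i block_index_less[OF i] by (simp add: mat_of_cols_index)
  qed (use B in \<open>auto simp: block_sums_def\<close>)
  finally show ?thesis .
qed

lemma mat_kernel_mult_iff:
  assumes A: "A \<in> carrier_mat d r" and P: "P \<in> carrier_mat r n" and y: "y \<in> carrier_vec n"
  shows "y \<in> mat_kernel (A * P) \<longleftrightarrow> P *\<^sub>v y \<in> mat_kernel A"
  using assms by (simp add: mat_kernel[OF A] mat_kernel[OF mult_carrier_mat[OF A P]])

text \<open>Spreading each entry evenly over its block gives a preimage.\<close>

lemma block_sums_surj:
  assumes m: "\<And>j. j < r \<Longrightarrow> 0 < m j" and w: "w \<in> carrier_vec r"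
  obtains y where "y \<in> carrier_vec (length (block_index m r))" "block_sums m r *\<^sub>v y = w"
proof
  let ?b = "block_index m r"
  let ?y = "vec (length ?b) (\<lambda>i. w $ (?b ! i) / m (?b ! i))"
  show "?y \<in> carrier_vec (length ?b)" by simp
  show "block_sums m r *\<^sub>v ?y = w"
  proof (rule eq_vecI)
    fix j assume "j < dim_vec w"
    then have j: "j < r" using w by simp
    have "(\<Sum>i\<in>block m r j. ?y $ i) = (\<Sum>i\<in>block m r j. w $ j / m j)"
      by (intro sum.cong) (auto simp: block_def)
    also have "\<dots> = w $ j" using j m[OF j] by (simp add: card_block)
    finally show "(block_sums m r *\<^sub>v ?y) $ j = w $ j"
      using j by (simp add: block_sums_mult_vec)
  qed (use w in \<open>auto simp: block_sums_def\<close>)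
qed

section \<open>A kernel spanned by sign vectors is rational\<close>

lemma finite_sign_vecs: "finite {v \<in> carrier_vec n. sign_vec v}"
proof (rule finite_subset)
  show "{v \<in> carrier_vec n. sign_vec v} \<subseteq> vec n ` (PiE {..<n} (\<lambda>_. {-1, 1}))"
  proof
    fix v assume v: "v \<in> {v \<in> carrier_vec n. sign_vec v}"
    then have "v = vec n (restrict (($) v) {..<n})" by (intro eq_vecI) auto
    moreover have "restrict (($) v) {..<n} \<in> PiE {..<n} (\<lambda>_. {-1, 1})"
      using v by (auto simp: sign_vec_def PiE_def Pi_def)
    ultimately show "v \<in> vec n ` (PiE {..<n} (\<lambda>_. {-1, 1}))" by blast
  qed
qed (intro finite_imageI finite_PiE; simp)

text \<open>The block sums of the sign vectors in the kernel of the repeated matrix form a finite set of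
  integer vectors. They span \<open>mat_kernel B\<close> since every vector of it is the vector of block sums of
  something, which then lies in the kernel of the repeated matrix.\<close>

lemma rational_if_repetition_spanned:
  assumes B: "B \<in> carrier_mat d r" and m: "\<And>j. j < r \<Longrightarrow> 0 < m j"
    and sp: "kernel_spanned_by_sign_vecs (repeat_cols m B)"
  shows "rational_subspace r (mat_kernel B)"
proof -
  let ?P = "block_sums m r" and ?N = "length (block_index m r)"
  let ?S = "{v \<in> mat_kernel (B * ?P). sign_vec v}"
  let ?T = "(\<lambda>y. ?P *\<^sub>v y) ` ?S"
  have BP: "B * ?P \<in> carrier_mat d ?N" using B by (rule mult_carrier_mat) simp
  have SN: "?S \<subseteq> carrier_vec ?N" using mat_kernel_carrier[OF BP] by auto
  have spS: "vspan ?N ?S = mat_kernel (B * ?P)"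
    using sp
    unfolding kernel_spanned_by_sign_vecs_def repeat_cols_eq_mult_block_sums[OF B]
      carrier_matD(2)[OF BP] .
  have "finite ?S" by (rule finite_subset[OF _ finite_sign_vecs[of ?N]]) (use SN in auto)
  then have "finite ?T" by simp
  moreover have T: "?T \<subseteq> carrier_vec r"
    using SN mult_mat_vec_carrier[OF block_sums_carrier] by blast
  moreover have "rational_vec v" if "v \<in> ?T" for v
  proof -
    from that obtain y where y: "y \<in> carrier_vec ?N" "sign_vec y" "v = ?P *\<^sub>v y"
      using SN by blast
    have "y $ i \<in> \<rat>" if "i < ?N" for i using y that by (auto simp: sign_vec_def)
    then show ?thesis unfolding y(3) block_sums_mult_vec[OF y(1)] rational_vec_def
      using block_subset by (fastforce intro: Rats_sum)
  qed
  moreover have "vspan r ?T = mat_kernel B"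
  proof
    show "vspan r ?T \<subseteq> mat_kernel B"
      using mat_kernel_mult_iff[OF B block_sums_carrier] SN
      by (intro vspan_least vsubspace_mat_kernel[OF B]) blast
    show "mat_kernel B \<subseteq> vspan r ?T"
    proof
      fix w assume w: "w \<in> mat_kernel B"
      then have "w \<in> carrier_vec r" using mat_kernel_carrier[OF B] by auto
      then obtain y where y: "y \<in> carrier_vec ?N" "?P *\<^sub>v y = w"
        using block_sums_surj m by metis
      then have "y \<in> vspan ?N ?S"
        using w mat_kernel_mult_iff[OF B block_sums_carrier y(1)] spS by simp
      then show "w \<in> vspan r ?T"
        using mult_vspan_subset[OF block_sums_carrier SN] y(2) by blast
    qed
  qed
  ultimately show ?thesis unfolding rational_subspace_mat_kernel_iff[OF B] by blast
qed

section \<open>Sign vectors in the kernel of an even repetition\<close>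

text \<open>A sign vector with \<open>h j\<close> positive entries in block \<open>j\<close> has block sum \<open>h j - (m j - h j)\<close>. The set
  of positive positions can be any set of the right size in each block; confining it between \<open>A\<close>
  and \<open>C\<close> allows the signs at a few positions to be prescribed.\<close>

lemma sign_vec_with_block_sums:
  assumes AC: "A \<subseteq> C" "C \<subseteq> {..<length (block_index m r)}"
    and h: "\<And>j. j < r \<Longrightarrow> card (A \<inter> block m r j) \<le> h j"
      "\<And>j. j < r \<Longrightarrow> h j \<le> card (C \<inter> block m r j)"
  obtains y where "y \<in> carrier_vec (length (block_index m r))" "sign_vec y"
    "\<And>i. i \<in> A \<Longrightarrow> y $ i = 1"
    "\<And>i. i < length (block_index m r) \<Longrightarrow> i \<notin> C \<Longrightarrow> y $ i = -1"
    "block_sums m r *\<^sub>v y = vec r (\<lambda>j. 2 * real (h j) - real (m j))"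
proof -
  let ?b = "block_index m r" let ?N = "length ?b"
  have "\<exists>T. A \<inter> block m r j \<subseteq> T \<and> T \<subseteq> C \<inter> block m r j \<and> card T = h j" if "j < r" for j
    using exists_subset_between[of "A \<inter> block m r j" "h j" "C \<inter> block m r j"] h[OF that] AC
    by auto
  then obtain T where T: "\<And>j. j < r \<Longrightarrow> A \<inter> block m r j \<subseteq> T j"
    "\<And>j. j < r \<Longrightarrow> T j \<subseteq> C \<inter> block m r j" "\<And>j. j < r \<Longrightarrow> card (T j) = h j"
    by metis
  let ?y = "vec ?N (\<lambda>i. if i \<in> T (?b ! i) then 1 else -1 :: real)"
  have mem: "i \<in> block m r (?b ! i)" if "i < ?N" for i using that by (simp add: block_def)
  show ?thesis
  proof
    show "?y \<in> carrier_vec ?N" by simp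
    show "sign_vec ?y" by (simp add: sign_vec_def)
    show "?y $ i = 1" if "i \<in> A" for i
    proof -
      have i: "i < ?N" using that AC by auto
      then show ?thesis using T(1)[OF block_index_less[OF i]] mem[OF i] that by auto
    qed
    show "?y $ i = -1" if i: "i < ?N" and "i \<notin> C" for i
      using T(2)[OF block_index_less[OF i]] that by auto
    show "block_sums m r *\<^sub>v ?y = vec r (\<lambda>j. 2 * real (h j) - real (m j))"
    proof (rule eq_vecI)
      fix j assume "j < dim_vec (vec r (\<lambda>j. 2 * real (h j) - real (m j)))"
      then have j: "j < r" by simp
      have sub: "T j \<subseteq> block m r j" using T(2)[OF j] by auto
      have "(\<Sum>i\<in>block m r j. ?y $ i) = (\<Sum>i\<in>block m r j. 2 * of_bool (i \<in> T j) - 1)"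
        by (intro sum.cong) (auto simp: block_def)
      also have "\<dots> = 2 * (\<Sum>i\<in>block m r j. of_bool (i \<in> T j)) - real (m j)"
        using j by (simp add: sum_subtractf sum_distrib_left card_block)
      also have "(\<Sum>i\<in>block m r j. of_bool (i \<in> T j)) = real (card (T j))"
        using sub by (simp add: Int_absorb1)
      finally show "(block_sums m r *\<^sub>v ?y) $ j = vec r (\<lambda>j. 2 * real (h j) - real (m j)) $ j"
        using j T(3)[OF j] by (simp add: block_sums_mult_vec)
    qed (simp add: block_sums_def)
  qed
qed

lemma unit_vec_diff_mem_mat_kernel_block_sums:
  assumes a: "a \<in> block m r j" and b: "b \<in> block m r j"
  shows "unit_vec (length (block_index m r)) a - unit_vec (length (block_index m r)) b
    \<in> mat_kernel (block_sums m r)" (is "?e \<in> _")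
proof -
  have "(\<Sum>i\<in>block m r l. ?e $ i) = 0" for l
  proof -
    have "(\<Sum>i\<in>block m r l. ?e $ i)
        = (\<Sum>i\<in>block m r l. (if i = a then 1 else 0) - (if i = b then 1 else 0))"
      using a b by (intro sum.cong) (auto simp: block_def)
    also have "\<dots> = 0" using a b by (auto simp: sum_subtractf block_def)
    finally show ?thesis .
  qed
  then have "block_sums m r *\<^sub>v ?e = 0\<^sub>v r"
    by (subst block_sums_mult_vec) (auto intro!: eq_vecI)
  then show ?thesis by (simp add: mat_kernel[OF block_sums_carrier])
qed

text \<open>The differences of unit vectors within a block span the vectors with vanishing block sums. If
  such a vector is nonzero at \<open>a\<close>, it is nonzero at another position \<open>b\<close> of the same block, and
  subtracting a multiple of the difference for \<open>a\<close> and \<open>b\<close> clears position \<open>a\<close> without creating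
  new nonzero positions; so induct on the size of the support.\<close>

lemma mat_kernel_block_sums_subset:
  assumes U: "vsubspace (length (block_index m r)) U"
    and diff: "\<And>j a b. a \<in> block m r j \<Longrightarrow> b \<in> block m r j \<Longrightarrow> a \<noteq> b \<Longrightarrow>
      unit_vec (length (block_index m r)) a - unit_vec (length (block_index m r)) b \<in> U"
  shows "mat_kernel (block_sums m r) \<subseteq> U"
proof
  let ?N = "length (block_index m r)" and ?P = "block_sums m r"
  note D = vsubspaceD[OF U]
  fix z assume "z \<in> mat_kernel ?P"
  then show "z \<in> U"
  proof (induction "card {i. i < ?N \<and> z $ i \<noteq> 0}" arbitrary: z rule: less_induct)
    case less
    have z: "z \<in> carrier_vec ?N" "?P *\<^sub>v z = 0\<^sub>v r"
      using less.prems by (auto simp: mat_kernel[OF block_sums_carrier])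
    show ?case
    proof (cases "\<exists>a<?N. z $ a \<noteq> 0")
      case False
      then have "z = 0\<^sub>v ?N" using z by (intro eq_vecI) auto
      then show ?thesis using D by simp
    next
      case True
      then obtain a where a: "a < ?N" "z $ a \<noteq> 0" by auto
      define j where "j = block_index m r ! a"
      have j: "j < r" using block_index_less[OF a(1)] by (simp add: j_def)
      have aj: "a \<in> block m r j" using a by (simp add: block_def j_def)
      have "(\<Sum>i\<in>block m r j. z $ i) = 0"
        using arg_cong[OF z(2), of "\<lambda>v. v $ j"] j by (simp add: block_sums_mult_vec[OF z(1)])
      then have "(\<Sum>i\<in>block m r j - {a}. z $ i) \<noteq> 0"
        using a(2) by (simp add: sum.remove[OF _ aj])
      then obtain b where b: "b \<in> block m r j" "b \<noteq> a" "z $ b \<noteq> 0"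
        by (metis (mono_tags, lifting) DiffE singletonI sum.neutral)
      have bN: "b < ?N" using b(1) by (simp add: block_def)
      let ?e = "unit_vec ?N a - unit_vec ?N b :: real vec"
      let ?z = "z - z $ a \<cdot>\<^sub>v ?e"
      have e: "?e \<in> U" using diff[OF aj b(1)] b(2) by simp
      have e0: "?e \<in> mat_kernel ?P"
        by (rule unit_vec_diff_mem_mat_kernel_block_sums[OF aj b(1)])
      note DP = vsubspaceD[OF vsubspace_mat_kernel[OF block_sums_carrier[of m r]]]
      have "?z \<in> U"
      proof (rule less.hyps)
        show "?z \<in> mat_kernel ?P" using DP(4,5) less.prems e0 by blast
        have "{i. i < ?N \<and> ?z $ i \<noteq> 0} \<subset> {i. i < ?N \<and> z $ i \<noteq> 0}"
        proof (rule psubsetI)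
          show "{i. i < ?N \<and> ?z $ i \<noteq> 0} \<subseteq> {i. i < ?N \<and> z $ i \<noteq> 0}"
            using a bN b z(1) by (auto simp: unit_vec_def split: if_splits)
          have "?z $ a = 0" using a b(2) bN z(1) by (simp add: unit_vec_def)
          then show "{i. i < ?N \<and> ?z $ i \<noteq> 0} \<noteq> {i. i < ?N \<and> z $ i \<noteq> 0}" using a by blast
        qed
        then show "card {i. i < ?N \<and> ?z $ i \<noteq> 0} < card {i. i < ?N \<and> z $ i \<noteq> 0}"
          by (intro psubset_card_mono) auto
      qed
      then have "?z + z $ a \<cdot>\<^sub>v ?e \<in> U" using D(3,4) e by blast
      moreover have "?z + z $ a \<cdot>\<^sub>v ?e = z" using z(1) by (intro eq_vecI) auto
      ultimately show ?thesis by simp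
    qed
  qed
qed

text \<open>Choose a sign vector that is balanced in every block, positive at \<open>a\<close> and negative at \<open>b\<close>.
  Exchanging these two signs keeps it balanced, and the two vectors differ by twice the wanted
  vector. Balance is possible because each block has even size.\<close>

lemma unit_vec_diff_mem_span_sign_vecs:
  assumes k: "0 < k" and a: "a \<in> block (\<lambda>_. 2 * k) r j" and b: "b \<in> block (\<lambda>_. 2 * k) r j"
    and "a \<noteq> b" and U: "vsubspace (length (block_index (\<lambda>_. 2 * k) r)) U"
    and sgn: "{v \<in> mat_kernel (block_sums (\<lambda>_. 2 * k) r). sign_vec v} \<subseteq> U"
  shows "unit_vec (length (block_index (\<lambda>_. 2 * k) r)) a
    - unit_vec (length (block_index (\<lambda>_. 2 * k) r)) b \<in> U" (is "?e \<in> U")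
proof -
  let ?m = "\<lambda>_. 2 * k" let ?N = "length (block_index ?m r)" and ?P = "block_sums ?m r"
  note D = vsubspaceD[OF U]
  have aN: "a < ?N" and bN: "b < ?N" using a b by (auto simp: block_def)
  have A: "card ({a} \<inter> block ?m r l) \<le> k" for l
    using k card_mono[of "{a}" "{a} \<inter> block ?m r l"] by simp
  have C: "k \<le> card (({..<?N} - {b}) \<inter> block ?m r l)" if "l < r" for l
  proof -
    have "({..<?N} - {b}) \<inter> block ?m r l = block ?m r l - {b}" using block_subset by blast
    moreover have "2 * k - 1 \<le> card (block ?m r l - {b})"
      using diff_card_le_card_Diff[of "{b}" "block ?m r l"] that by (simp add: card_block)
    ultimately show ?thesis using k by simp
  qed
  obtain y where y: "y \<in> carrier_vec ?N" "sign_vec y" "y $ a = 1" "y $ b = -1"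
    "?P *\<^sub>v y = vec r (\<lambda>j. 2 * real k - real (2 * k))"
    by (rule sign_vec_with_block_sums[of "{a}" "{..<?N} - {b}" ?m r "\<lambda>_. k"])
      (use A C aN bN \<open>a \<noteq> b\<close> in auto)
  have yK: "y \<in> mat_kernel ?P"
    using y(1,5) by (auto simp: mat_kernel[OF block_sums_carrier] intro!: eq_vecI)
  \<comment> \<open>Subtracting \<open>2\<close> at \<open>a\<close> and adding \<open>2\<close> at \<open>b\<close> exchanges the entries \<open>1\<close> and \<open>-1\<close>.\<close>
  let ?y = "y - 2 \<cdot>\<^sub>v ?e"
  have "?y \<in> mat_kernel ?P"
    using vsubspaceD(4,5)[OF vsubspace_mat_kernel[OF block_sums_carrier]] yK
      unit_vec_diff_mem_mat_kernel_block_sums[OF a b] by blast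
  moreover have "sign_vec ?y"
    using y(1-4) aN bN \<open>a \<noteq> b\<close> by (auto simp: sign_vec_def unit_vec_def)
  ultimately have "?y \<in> U" "y \<in> U" using sgn yK y(2) by auto
  then have "(1/2) \<cdot>\<^sub>v (y - ?y) \<in> U" using D(4,5) by blast
  moreover have "(1/2) \<cdot>\<^sub>v (y - ?y) = ?e" using y(1) by (intro eq_vecI) auto
  ultimately show ?thesis by simp
qed

text \<open>Block \<open>j\<close> needs \<open>k + f j\<close> positive entries out of \<open>2 * k\<close>; the bound on \<open>f\<close> says that this
  number lies between \<open>0\<close> and \<open>2 * k\<close>.\<close>

lemma even_vec_is_block_sums_of_sign_vec:
  assumes f: "\<And>j. j < r \<Longrightarrow> \<bar>f j\<bar> \<le> int k"
  obtains y where "y \<in> carrier_vec (length (block_index (\<lambda>_. 2 * k) r))" "sign_vec y"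
    "block_sums (\<lambda>_. 2 * k) r *\<^sub>v y = vec r (\<lambda>j. 2 * of_int (f j))"
proof -
  let ?m = "\<lambda>_. 2 * k" let ?N = "length (block_index ?m r)"
  define h where "h j = nat (int k + f j)" for j
  have "h j \<le> card ({..<?N} \<inter> block ?m r j)" if "j < r" for j
    using f[OF that] that block_subset[of ?m r j] by (simp add: Int_absorb1 card_block h_def)
  then obtain y where y: "y \<in> carrier_vec ?N" "sign_vec y"
    "block_sums ?m r *\<^sub>v y = vec r (\<lambda>j. 2 * real (h j) - real (2 * k))"
    using sign_vec_with_block_sums[of "{}" "{..<?N}" ?m r h] by auto
  have "real (h j) = real k + of_int (f j)" if "j < r" for j
    using f[OF that] by (simp add: h_def)
  then have "block_sums ?m r *\<^sub>v y = vec r (\<lambda>j. 2 * of_int (f j))"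
    unfolding y(3) by (intro eq_vecI) auto
  then show ?thesis using that y by blast
qed

section \<open>Rational kernels and large even repetitions\<close>

lemma common_denominator:
  assumes "rational_vec v"
  obtains q :: int and f :: "nat \<Rightarrow> int"
  where "0 < q" "\<And>j. j < dim_vec v \<Longrightarrow> v $ j = of_int (f j) / of_int q"
proof -
  have "\<exists>a b. 0 < b \<and> v $ j = of_int a / of_int b" if "j < dim_vec v" for j
    using assms that unfolding rational_vec_def by (metis Rats_cases')
  then obtain a b where ab: "\<And>j. j < dim_vec v \<Longrightarrow> 0 < b j"
    "\<And>j. j < dim_vec v \<Longrightarrow> v $ j = of_int (a j) / of_int (b j)"
    by metis
  let ?q = "\<lambda>J. \<Prod>j\<in>J. b j"
  show ?thesis
  proof (rule that[of "?q {..<dim_vec v}" "\<lambda>j. a j * ?q ({..<dim_vec v} - {j})"])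
    show "0 < ?q {..<dim_vec v}" using ab(1) by (intro prod_pos) auto
    fix j assume j: "j < dim_vec v"
    define p where "p = ?q ({..<dim_vec v} - {j})"
    have "0 < p" unfolding p_def using ab(1) by (intro prod_pos) auto
    then have "v $ j = of_int (a j * p) / of_int (b j * p)" using ab(2)[OF j] by simp
    moreover have "?q {..<dim_vec v} = b j * p"
      unfolding p_def using j by (intro prod.remove) auto
    ultimately show "v $ j = of_int (a j * ?q ({..<dim_vec v} - {j})) / of_int (?q {..<dim_vec v})"
      unfolding p_def[symmetric] by (simp only:)
  qed
qed

text \<open>The scalar accounts for clearing denominators, and for the factor \<open>2\<close> that parity forces in
  blocks of even size.\<close>

definition sign_liftable :: "(nat \<Rightarrow> nat) \<Rightarrow> nat \<Rightarrow> real vec \<Rightarrow> bool" where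
  "sign_liftable m r v \<longleftrightarrow> (\<exists>c y. y \<in> carrier_vec (length (block_index m r)) \<and>
    sign_vec y \<and> c \<noteq> 0 \<and> block_sums m r *\<^sub>v y = c \<cdot>\<^sub>v v)"

lemma eventually_sign_liftable:
  assumes v: "rational_vec v" "v \<in> carrier_vec r"
  shows "\<forall>\<^sub>F k in sequentially. sign_liftable (\<lambda>_. 2 * k) r v"
proof -
  obtain q f where q: "0 < q" and f: "\<And>j. j < dim_vec v \<Longrightarrow> v $ j = of_int (f j) / of_int q"
    using common_denominator[OF v(1)] by blast
  \<comment> \<open>The sum is a crude bound for all \<open>\<bar>f j\<bar>\<close>; unlike a maximum it also makes sense for \<open>r = 0\<close>.\<close>
  define K where "K = nat (\<Sum>j<r. \<bar>f j\<bar>)"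
  show ?thesis
  proof (rule eventually_sequentiallyI[of K])
    fix k assume "K \<le> k"
    have "\<bar>f j\<bar> \<le> int k" if "j < r" for j
    proof -
      have "\<bar>f j\<bar> \<le> (\<Sum>j<r. \<bar>f j\<bar>)" using that by (intro member_le_sum) auto
      then show ?thesis using \<open>K \<le> k\<close> by (simp add: K_def)
    qed
    then obtain y where y: "y \<in> carrier_vec (length (block_index (\<lambda>_. 2 * k) r))" "sign_vec y"
      "block_sums (\<lambda>_. 2 * k) r *\<^sub>v y = vec r (\<lambda>j. 2 * of_int (f j))"
      using even_vec_is_block_sums_of_sign_vec by blast
    have "vec r (\<lambda>j. 2 * of_int (f j)) = (2 * of_int q) \<cdot>\<^sub>v v"
      using v(2) f q by (intro eq_vecI) auto
    then show "sign_liftable (\<lambda>_. 2 * k) r v"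
      unfolding sign_liftable_def using y q by (intro exI[of _ "2 * of_int q"] exI[of _ y]) auto
  qed
qed

text \<open>The span of the sign vectors in the kernel of the repeated matrix contains the kernel of
  \<open>block_sums\<close> and, by liftability of the generators of \<open>mat_kernel B\<close>, has all of \<open>mat_kernel B\<close> as
  its image. A subspace with these two properties is the full preimage of \<open>mat_kernel B\<close>.\<close>

lemma even_repetition_spanned:
  assumes B: "B \<in> carrier_mat d r" and k: "0 < k" and S: "vspan r S = mat_kernel B"
    and Sc: "S \<subseteq> carrier_vec r"
    and lift: "\<And>v. v \<in> S \<Longrightarrow> sign_liftable (\<lambda>_. 2 * k) r v"
  shows "kernel_spanned_by_sign_vecs (repeat_cols (\<lambda>_. 2 * k) B)"
proof -
  let ?m = "\<lambda>_. 2 * k" let ?N = "length (block_index ?m r)" and ?P = "block_sums ?m r"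
  let ?G = "{v \<in> mat_kernel (B * ?P). sign_vec v}"
  let ?U = "vspan ?N ?G"
  have BP: "B * ?P \<in> carrier_mat d ?N" using B by (rule mult_carrier_mat) simp
  note ker = mat_kernel_mult_iff[OF B block_sums_carrier]
  have G: "?G \<subseteq> carrier_vec ?N" using mat_kernel_carrier[OF BP] by auto
  note U = vsubspace_vspan[OF G] and GU = subset_vspan[OF G]
  note D = vsubspaceD[OF U] and DB = vsubspaceD[OF vsubspace_mat_kernel[OF B]]
  have "mat_kernel ?P \<subseteq> mat_kernel (B * ?P)"
    by (rule mat_kernel_mult_subset[OF block_sums_carrier B])
  then have "{v \<in> mat_kernel ?P. sign_vec v} \<subseteq> ?U" using GU by auto
  then have ker_P: "mat_kernel ?P \<subseteq> ?U"
    using unit_vec_diff_mem_span_sign_vecs[OF k _ _ _ U]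
    by (intro mat_kernel_block_sums_subset[OF U])
  have "S \<subseteq> (\<lambda>y. ?P *\<^sub>v y) ` ?U"
  proof
    fix v assume v: "v \<in> S"
    then have vK: "v \<in> mat_kernel B" using subset_vspan[OF Sc] S by auto
    obtain c y where y: "y \<in> carrier_vec ?N" "sign_vec y" "c \<noteq> 0" "?P *\<^sub>v y = c \<cdot>\<^sub>v v"
      using lift[OF v] unfolding sign_liftable_def by blast
    have "y \<in> ?G" using ker[OF y(1)] y DB(4)[OF vK] by simp
    then have "(1 / c) \<cdot>\<^sub>v y \<in> ?U" using GU D(4) by blast
    moreover have "?P *\<^sub>v ((1 / c) \<cdot>\<^sub>v y) = v"
      using mult_mat_vec[OF block_sums_carrier y(1)] y(3,4) by (simp add: smult_smult_assoc)
    ultimately show "v \<in> (\<lambda>y. ?P *\<^sub>v y) ` ?U" by force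
  qed
  then have onto: "mat_kernel B \<subseteq> (\<lambda>y. ?P *\<^sub>v y) ` ?U"
    using vspan_least[OF _ vsubspace_image[OF block_sums_carrier U], of S] S by simp
  have "mat_kernel (B * ?P) \<subseteq> ?U"
  proof
    fix y assume y: "y \<in> mat_kernel (B * ?P)"
    then have yc: "y \<in> carrier_vec ?N" using mat_kernel_carrier[OF BP] by auto
    then obtain u where u: "u \<in> ?U" "?P *\<^sub>v y = ?P *\<^sub>v u" using ker[OF yc] y onto by auto
    have uc: "u \<in> carrier_vec ?N" using D(1) u by auto
    have "?P *\<^sub>v (y - u) = ?P *\<^sub>v y - ?P *\<^sub>v u"
      by (rule mult_minus_distrib_mat_vec[OF block_sums_carrier yc uc])
    also have "\<dots> = 0\<^sub>v r"
      unfolding u(2) by (rule minus_cancel_vec[OF mult_mat_vec_carrier[OF block_sums_carrier uc]])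
    finally have "y - u \<in> mat_kernel ?P"
      by (rule mat_kernelI[OF block_sums_carrier minus_carrier_vec[OF yc uc]])
    then have "(y - u) + u \<in> ?U" using ker_P u(1) D(3) by blast
    moreover have "(y - u) + u = y" using yc uc by (intro eq_vecI) auto
    ultimately show "y \<in> ?U" by simp
  qed
  moreover have "?U \<subseteq> mat_kernel (B * ?P)"
    by (intro vspan_least vsubspace_mat_kernel[OF BP]) auto
  ultimately have "?U = mat_kernel (B * ?P)" by (rule subset_antisym[rotated])
  then show ?thesis
    unfolding kernel_spanned_by_sign_vecs_def repeat_cols_eq_mult_block_sums[OF B]
      carrier_matD(2)[OF BP] .
qed

lemma eventually_spanned_if_rational:
  assumes B: "B \<in> carrier_mat d r" and rat: "rational_subspace r (mat_kernel B)"
  shows "\<forall>\<^sub>F k in sequentially. kernel_spanned_by_sign_vecs (repeat_cols (\<lambda>_. 2 * k) B)"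
proof -
  obtain S where S: "finite S" "S \<subseteq> carrier_vec r" "\<forall>v\<in>S. rational_vec v"
    "vspan r S = mat_kernel B"
    using rat unfolding rational_subspace_mat_kernel_iff[OF B] by blast
  have "\<forall>\<^sub>F k in sequentially. \<forall>v\<in>S. sign_liftable (\<lambda>_. 2 * k) r v"
    using S(2,3)
    by (intro eventually_ball_finite[OF S(1)] ballI eventually_sign_liftable) auto
  then show ?thesis
    using eventually_gt_at_top[of 0]
  proof eventually_elim
    case (elim k)
    show ?case using elim even_repetition_spanned[OF B elim(2) S(4,2)] by blast
  qed
qed

theorem theoremB:
  fixes B :: "real mat" and d r :: nat
  assumes "B \<in> carrier_mat d r"
  shows "((\<exists>m. (\<forall>j<r. 0 < m j) \<and> kernel_spanned_by_sign_vecs (repeat_cols m B))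
            \<longleftrightarrow> rational_subspace r (mat_kernel B))
       \<and> (rational_subspace r (mat_kernel B)
            \<longleftrightarrow> (\<forall>\<^sub>F k in sequentially. kernel_spanned_by_sign_vecs (repeat_cols (\<lambda>_. 2 * k) B)))"
proof -
  have *: "\<exists>m. (\<forall>j<r. 0 < m j) \<and> kernel_spanned_by_sign_vecs (repeat_cols m B)"
    if "\<forall>\<^sub>F k in sequentially. kernel_spanned_by_sign_vecs (repeat_cols (\<lambda>_. 2 * k) B)"
  proof -
    have "\<forall>\<^sub>F k in sequentially. 0 < k \<and> kernel_spanned_by_sign_vecs (repeat_cols (\<lambda>_. 2 * k) B)"
      using eventually_gt_at_top[of 0] that by eventually_elim simp
    then obtain k where "0 < k" "kernel_spanned_by_sign_vecs (repeat_cols (\<lambda>_. 2 * k) B)"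
      using eventually_happens'[OF sequentially_bot] by blast
    then show ?thesis by (intro exI[of _ "\<lambda>_. 2 * k"]) simp
  qed
  show ?thesis
    using * rational_if_repetition_spanned[OF assms] eventually_spanned_if_rational[OF assms]
    by blast
qed

end
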